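(* If $M\geq 1$ is an arbitrary real number, then there exist a GCD closed set $S=\{x_1,x_2,\ldots,x_n\}$ of distinct positive integers and a real number $\alpha_0$ such that $\alpha_0>M$ and the power LCM matrix $[(\mathrm{lcm}(x_i,x_j))^{\alpha_0}]$ is singular.
   Context: A finite set $S=\{x_1,\ldots,x_n\}$ of distinct positive integers is GCD closed if $\gcd(x_i,x_j)\in S$ for all $i,j$. For real $\alpha$, the power LCM matrix $[(\mathrm{lcm}(x_i,x_j))^{\alpha}]$ is the $n\times n$ real matrix whose $ij$ entry is $(\mathrm{lcm}(x_i,x_j))^{\alpha}$. *)

theory Defs
  imports Complex_Main "Jordan_Normal_Form.Determinant"
begin

definition gcd_closed :: "nat set \<Rightarrow> bool" where
  "gcd_closed S \<longleftrightarrow>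
     finite S \<and> (\<forall>a\<in>S. a > 0) \<and> (\<forall>a\<in>S. \<forall>b\<in>S. gcd a b \<in> S)"

(* Indices start at 0, so the elements x_1, ..., x_n are x 0, ..., x (n - 1). *)
definition power_lcm_matrix :: "nat \<Rightarrow> (nat \<Rightarrow> nat) \<Rightarrow> real \<Rightarrow> real mat" where
  "power_lcm_matrix n x \<alpha> = mat n n (\<lambda>(i, j). real (lcm (x i) (x j)) powr \<alpha>)"

end

theory Submission
  imports Defs
begin

text \<open>
  Since lcm(s, t) gcd(s, t) = s t, the power LCM matrix is singular as soon as the matrix of
  the powers gcd(s, t) to the exponent - \<open>\<alpha>\<close> is.  For pairwise coprime c < p < q < r take
  S = {1, c, p, q, r, pq, pr, qr, cpqr}.  The Moebius function \<open>\<mu>\<close>(., cpqr) of S vanishes at 1,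
  because the order complex of the open interval (1, cpqr) is a circle (p, q, r and their pairwise
  products) plus a point (c), so its reduced Euler characteristic is zero.  The vector \<open>\<mu>\<close> is
  annihilated by all rows of the gcd matrix except the row of cpqr, where it gives \<open>\<Psi>\<close>(\<open>\<alpha>\<close>).
  If c, p, q, r are large and close together, \<open>\<Psi>\<close> is positive at a prescribed exponent, where the
  three terms of p, q, r outweigh that of c, but it is eventually negative since c is the smallest;
  so \<open>\<Psi>\<close> has a zero in between.
\<close>

text \<open>Since lcm(s, t) = s t / gcd(s, t), a kernel vector \<open>\<mu>\<close> of the matrix of
  the powers gcd(s, t) powr - \<alpha> yields the kernel vector \<open>v\<close>, with entries
  \<mu>(t) t powr - \<alpha>, of the LCM matrix; its entry at \<open>s\<^sub>0\<close> is
  nonzero.\<close>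

lemma det_power_lcm_matrix_eq_0I:
  fixes \<mu> :: "nat \<Rightarrow> real"
  assumes bij: "bij_betw x {..<n} S"
    and pos: "\<And>s. s \<in> S \<Longrightarrow> s > 0"
    and ker: "\<And>s. s \<in> S \<Longrightarrow> (\<Sum>t\<in>S. \<mu> t * real (gcd s t) powr - \<alpha>) = 0"
    and nz: "s\<^sub>0 \<in> S" "\<mu> s\<^sub>0 \<noteq> 0"
  shows "det (power_lcm_matrix n x \<alpha>) = 0"
proof -
  let ?A = "power_lcm_matrix n x \<alpha>"
  define v where "v = vec n (\<lambda>j. \<mu> (x j) * real (x j) powr - \<alpha>)"
  have lcm_powr: "real (lcm s t) powr \<alpha> * real t powr - \<alpha> = real s powr \<alpha> * real (gcd s t) powr - \<alpha>"
    if "s \<in> S" "t \<in> S" for s t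
  proof -
    have st: "s > 0" "t > 0" using pos that by auto
    have "real s * real t = real (gcd s t) * real (lcm s t)"
      by (metis of_nat_mult prod_gcd_lcm_nat)
    hence "real s powr \<alpha> * real t powr \<alpha> = real (gcd s t) powr \<alpha> * real (lcm s t) powr \<alpha>"
      by (metis powr_mult of_nat_0_le_iff)
    moreover have "real t powr \<alpha> \<noteq> 0" "real (gcd s t) powr \<alpha> \<noteq> 0"
      using st by simp_all
    ultimately show ?thesis by (simp add: powr_minus field_simps)
  qed
  have A: "?A \<in> carrier_mat n n" by (simp add: power_lcm_matrix_def)
  have v: "v \<in> carrier_vec n" by (simp add: v_def)
  have "?A *\<^sub>v v = 0\<^sub>v n"
  proof (rule eq_vecI)
    fix i assume "i < dim_vec (0\<^sub>v n :: real vec)"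
    hence i: "i < n" by simp
    hence xi: "x i \<in> S" using bij by (auto simp: bij_betw_def)
    have "(?A *\<^sub>v v) $ i
        = (\<Sum>j<n. real (lcm (x i) (x j)) powr \<alpha> * (\<mu> (x j) * real (x j) powr - \<alpha>))"
      using i by (simp add: power_lcm_matrix_def v_def scalar_prod_def atLeast0LessThan)
    also have "\<dots> = (\<Sum>t\<in>S. real (lcm (x i) t) powr \<alpha> * (\<mu> t * real t powr - \<alpha>))"
      by (rule sum.reindex_bij_betw [OF bij])
    also have "\<dots> = (\<Sum>t\<in>S. real (x i) powr \<alpha> * (\<mu> t * real (gcd (x i) t) powr - \<alpha>))"
      using lcm_powr [OF xi] by (intro sum.cong refl) (metis mult.left_commute)
    also have "\<dots> = 0"
      using ker [OF xi] by (simp add: sum_distrib_left [symmetric])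
    finally show "(?A *\<^sub>v v) $ i = 0\<^sub>v n $ i" using i by simp
  qed (simp add: power_lcm_matrix_def)
  moreover have "v \<noteq> 0\<^sub>v n"
  proof
    assume v0: "v = 0\<^sub>v n"
    obtain j where j: "j < n" "x j = s\<^sub>0"
      using bij nz(1) by (auto simp: bij_betw_def)
    have "v $ j = 0" using v0 j by simp
    thus False using j nz pos [OF nz(1)] by (simp add: v_def)
  qed
  ultimately show ?thesis
    using det_0_iff_vec_prod_zero_field [OF A] v by blast
qed

locale coprime_quadruple =
  fixes c p q r :: nat
  assumes gt1: "1 < c" and less: "c < p" "p < q" "q < r"
    and cop: "coprime c p" "coprime c q" "coprime c r" "coprime p q" "coprime p r" "coprime q r"
begin

definition "S = {1, c, p, q, r, p * q, p * r, q * r, c * p * q * r}"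

definition "P = {p, q, r, c * p * q * r}"

definition "N = {c, p * q, p * r, q * r}"

text \<open>The Moebius values \<mu>(t, cpqr) of S: 1 on \<open>P\<close>, -1 on \<open>N\<close>, 0
  at 1. As a difference of indicators it splits sums over S into one over \<open>P\<close> and one
  over \<open>N\<close>.\<close>

definition \<mu> :: "nat \<Rightarrow> real" where
  "\<mu> t = of_bool (t \<in> P) - of_bool (t \<in> N)"

definition \<Psi> :: "real \<Rightarrow> real" where
  "\<Psi> \<alpha> = real (c * p * q * r) powr - \<alpha>
     - real (p * q) powr - \<alpha> - real (p * r) powr - \<alpha> - real (q * r) powr - \<alpha>
     + real p powr - \<alpha> + real q powr - \<alpha> + real r powr - \<alpha> - real c powr - \<alpha>"

lemma pos: "0 < c" "0 < p" "0 < q" "0 < r"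
  using gt1 less by auto

lemma gcds:
  "gcd c p = 1" "gcd c q = 1" "gcd c r = 1" "gcd p q = 1" "gcd p r = 1" "gcd q r = 1"
  "gcd c (p * q) = 1" "gcd c (p * r) = 1" "gcd c (q * r) = 1"
  "gcd p (p * q) = p" "gcd p (p * r) = p" "gcd p (q * r) = 1"
  "gcd q (p * q) = q" "gcd q (p * r) = 1" "gcd q (q * r) = q"
  "gcd r (p * q) = 1" "gcd r (p * r) = r" "gcd r (q * r) = r"
  "gcd (p * q) (p * r) = p" "gcd (p * q) (q * r) = q" "gcd (p * r) (q * r) = r"
proof -
  show "gcd (p * q) (p * r) = p"
    using cop(6) by (simp add: gcd_mult_distrib_nat [symmetric])
  show "gcd (p * q) (q * r) = q"
    using cop(5) gcd_mult_distrib_nat [of q p r] by (simp add: mult.commute)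
  show "gcd (p * r) (q * r) = r"
    using cop(4) gcd_mult_distrib_nat [of r p q] by (simp add: mult.commute)
qed (use cop in \<open>simp_all add: coprime_iff_gcd_eq_1 [symmetric] coprime_commute gcd_proj1_if_dvd_nat\<close>)

lemma gcd_top:
  assumes "s \<in> S" shows "gcd s (c * p * q * r) = s"
proof -
  have "c * p * q * r = (p * q) * (c * r)" "c * p * q * r = (p * r) * (c * q)"
    "c * p * q * r = (q * r) * (c * p)"
    by simp_all
  hence "p * q dvd c * p * q * r" "p * r dvd c * p * q * r" "q * r dvd c * p * q * r"
    by (metis dvd_triv_left)+
  hence "s dvd c * p * q * r" using assms by (auto simp: S_def)
  thus ?thesis by (rule gcd_proj1_if_dvd_nat)
qed

lemma gcd_closed_S: "gcd_closed S"
proof -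
  have top: "gcd a b \<in> S" if "a \<in> S" "b = c * p * q * r" for a b
    using gcd_top that by simp
  have "gcd a b \<in> S" if "a \<in> S" "b \<in> S" for a b
  proof (cases "a = c * p * q * r \<or> b = c * p * q * r")
    case True
    thus ?thesis using top that by (metis gcd.commute)
  next
    case False
    hence "a \<in> {1, c, p, q, r, p * q, p * r, q * r}" "b \<in> {1, c, p, q, r, p * q, p * r, q * r}"
      using that by (auto simp: S_def)
    hence "gcd a b \<in> {1, c, p, q, r, p * q, p * r, q * r}"
      \<comment> \<open>The \<open>THEN\<close> form supplies the equations of \<open>gcds\<close>
        with swapped arguments.\<close>
      by (elim insertE emptyE; simp add: gcds gcds [THEN trans [OF gcd.commute]])
    thus ?thesis by (auto simp: S_def)
  qed
  thus ?thesis using pos by (auto simp: gcd_closed_def S_def)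
qed

text \<open>With the order of c, p, q, r this gives the chains p < q < r < cpqr and c < pq < pr <
  qr, hence distinctness within \<open>P\<close> and within \<open>N\<close>.\<close>

lemma less_prods:
  "c < p * q" "p * q < p * r" "p * r < q * r" "r < c * p * q * r"
proof -
  show "p * q < p * r" "p * r < q * r"
    using less pos by simp_all
  have "p \<le> p * q" using pos by simp
  thus "c < p * q" using less by linarith
  have "1 < c * (p * q)"
    using gt1 pos by (metis less_1_mult mult_eq_1_iff nat_0_less_mult_iff nat_neq_iff less_one mult.right_neutral)
  thus "r < c * p * q * r"
    using pos by (simp add: mult.assoc)
qed

lemma sum_S:
  "(\<Sum>t\<in>S. \<mu> t * f t) =
     f (c * p * q * r) - f (p * q) - f (p * r) - f (q * r) + f p + f q + f r - f c"
proof -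
  have fin: "finite S" and PN: "S \<inter> P = P" "S \<inter> N = N"
    by (auto simp: S_def P_def N_def)
  have "\<mu> t * f t = (if t \<in> P then f t else 0) - (if t \<in> N then f t else 0)" for t
    by (simp add: \<mu>_def)
  hence "(\<Sum>t\<in>S. \<mu> t * f t) = sum f P - sum f N"
    using sum.inter_restrict [OF fin, of f P] sum.inter_restrict [OF fin, of f N] PN
    by (simp add: sum_subtractf)
  moreover have "p \<notin> {q, r, c * p * q * r}" "q \<notin> {r, c * p * q * r}" "r \<notin> {c * p * q * r}"
    "c \<notin> {p * q, p * r, q * r}" "p * q \<notin> {p * r, q * r}" "p * r \<notin> {q * r}"
    by (intro notI; elim insertE emptyE; use less less_prods in linarith)+
  ultimately show ?thesis
    unfolding P_def N_def by (simp only: sum.insert finite_insert finite.emptyI sum.empty simp_thms) simp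
qed

lemma det_eq_0:
  assumes "bij_betw x {..<n} S" "\<Psi> \<alpha> = 0"
  shows "det (power_lcm_matrix n x \<alpha>) = 0"
proof (rule det_power_lcm_matrix_eq_0I [OF assms(1), where \<mu> = \<mu> and s\<^sub>0 = c])
  show "s > 0" if "s \<in> S" for s
    using that pos by (auto simp: S_def)
  show "c \<in> S"
    by (simp add: S_def)
  \<comment> \<open>Every element of \<open>P\<close> exceeds c, so the two indicators cannot cancel
    at c.\<close>
  have "c \<notin> P"
    unfolding P_def by (intro notI; elim insertE emptyE; use less less_prods in linarith)
  thus "\<mu> c \<noteq> 0"
    by (simp add: \<mu>_def N_def)
  fix s assume "s \<in> S"
  then consider "s = c * p * q * r" | "s \<in> {1, c, p, q, r, p * q, p * r, q * r}"
    by (auto simp: S_def)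
  thus "(\<Sum>t\<in>S. \<mu> t * real (gcd s t) powr - \<alpha>) = 0"
  proof cases
    case 1
    have "(\<Sum>t\<in>S. \<mu> t * real (gcd s t) powr - \<alpha>) = (\<Sum>t\<in>S. \<mu> t * real t powr - \<alpha>)"
      using gcd_top 1 by (intro sum.cong) (auto simp: gcd.commute)
    also have "\<dots> = \<Psi> \<alpha>"
      unfolding sum_S \<Psi>_def ..
    finally show ?thesis using assms(2) by simp
  next
    case 2
    \<comment> \<open>Below the top the eight terms cancel in pairs; for s = p, say, each sign
      carries two copies of p powr - \<alpha> and two of 1.\<close>
    thus ?thesis unfolding sum_S gcd_top [OF \<open>s \<in> S\<close>]
      by (elim insertE emptyE; simp add: gcds gcds [THEN trans [OF gcd.commute]])
  qed
qed

lemma root_exists: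
  assumes \<beta>: "\<beta> > 0" and c: "real c powr \<beta> \<ge> 3"
    and close: "(real r / real c) powr \<beta> \<le> 3 / 2"
  shows "\<exists>\<alpha>\<ge>\<beta>. \<Psi> \<alpha> = 0"
proof -
  have "0 < \<Psi> \<beta>"
  proof -
    \<comment> \<open>In units of C, the terms of p, q, r give at least 3 * 2/3 = 2, while the three
      products cost at most 3 * 1/3 = 1 and c costs 1; the positive term of cpqr makes the
      inequality strict.\<close>
    define C where "C = real c powr - \<beta>"
    have C: "0 < C" "C \<le> 1 / 3"
      using c pos by (simp_all add: C_def powr_minus field_simps)
    have "2 / 3 * C \<le> real r powr - \<beta>"
      using close pos by (simp add: C_def powr_minus powr_divide field_simps)
    moreover have "real r powr - \<beta> \<le> real q powr - \<beta>" "real q powr - \<beta> \<le> real p powr - \<beta>"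
      using \<beta> less pos by (auto intro!: powr_mono2')
    moreover have small: "real (a * b) powr - \<beta> \<le> C / 3" if "c \<le> a" "c \<le> b" for a b
    proof -
      have "real (a * b) powr - \<beta> \<le> real (c * c) powr - \<beta>"
        using \<beta> pos that by (intro powr_mono2') (auto simp flip: of_nat_mult intro: mult_mono)
      also have "\<dots> = C * C" by (simp add: C_def powr_mult)
      also have "\<dots> \<le> C * (1 / 3)" using C by (intro mult_left_mono) auto
      finally show ?thesis by simp
    qed
    moreover have "real (c * p * q * r) powr - \<beta> > 0" using pos by simp
    ultimately show ?thesis
      unfolding \<Psi>_def C_def [symmetric] using C(1) less small [of p q] small [of p r] small [of q r]
      by linarith
  qed
  moreover obtain \<gamma> where \<gamma>: "\<gamma> \<ge> \<beta>" "\<Psi> \<gamma> < 0"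
  proof
    \<comment> \<open>The logarithm makes c powr - \<gamma> at least 4 times p powr - \<gamma>,
      which outweighs the three terms of p, q, r.\<close>
    define \<gamma> where "\<gamma> = max \<beta> (log (real p / real c) 4)"
    have ratio: "real p / real c > 1" using less pos by simp
    show "\<gamma> \<ge> \<beta>" by (simp add: \<gamma>_def)
    hence "\<gamma> > 0" using \<beta> by simp
    have "4 = (real p / real c) powr log (real p / real c) 4"
      using ratio by (intro powr_log_cancel [symmetric]) auto
    also have "\<dots> \<le> (real p / real c) powr \<gamma>"
      using ratio by (intro powr_mono) (auto simp: \<gamma>_def)
    finally have "4 * real p powr - \<gamma> \<le> real c powr - \<gamma>"
      using pos by (simp add: powr_minus powr_divide field_simps)
    moreover have "real r powr - \<gamma> \<le> real p powr - \<gamma>" "real q powr - \<gamma> \<le> real p powr - \<gamma>"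
      using \<open>\<gamma> > 0\<close> less pos by (auto intro!: powr_mono2')
    \<comment> \<open>The remaining positive term is absorbed by the negative term of qr.\<close>
    moreover have "real (c * p * q * r) powr - \<gamma> \<le> real (q * r) powr - \<gamma>"
    proof (intro powr_mono2')
      have "q * r \<le> (c * p) * (q * r)" using pos by simp
      thus "real (q * r) \<le> real (c * p * q * r)" unfolding of_nat_le_iff by (simp only: mult.assoc)
    qed (use \<open>\<gamma> > 0\<close> pos in auto)
    moreover have "real (p * q) powr - \<gamma> > 0" "real (p * r) powr - \<gamma> > 0" "real p powr - \<gamma> > 0"
      using pos by simp_all
    ultimately show "\<Psi> \<gamma> < 0" unfolding \<Psi>_def by linarith
  qed
  moreover have "continuous_on {\<beta>..\<gamma>} \<Psi>"
    unfolding \<Psi>_def using pos by (intro continuous_intros) auto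
  ultimately show ?thesis
    using IVT2' [of \<Psi> \<gamma> 0 \<beta>] by force
qed

end

text \<open>The differences are 1, 2, 3 and 4, and gcd(a, a + d) = gcd(a, d): 6t + 1 and 6t + 3 are
  odd, and 3 does not divide 6t + 2.\<close>

lemma coprime_quadruple_6:
  assumes "t \<ge> 1"
  shows "coprime_quadruple (6 * t + 1) (6 * t + 2) (6 * t + 3) (6 * t + 5)"
proof -
  have shift: "coprime a b" if "coprime a d" "b = a + d" for a b d :: nat
    using that by (simp add: coprime_iff_gcd_eq_1)
  have two: "coprime (6 * t + 1) 2" "coprime (6 * t + 3) 2"
    by (simp_all add: coprime_right_2_iff_odd)
  have "coprime (6 * t + 1) (2 ^ 2)"
    using two(1) by (intro coprime_power_right_iff [THEN iffD2] disjI1)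
  hence four: "coprime (6 * t + 1) 4"
    by simp
  have "coprime 3 (2 :: nat)"
    by (simp add: coprime_right_2_iff_odd)
  moreover have "6 * t + 2 = 2 * t * 3 + 2"
    by simp
  ultimately have "coprime 3 (6 * t + 2)"
    by (simp only: coprime_iff_gcd_eq_1 gcd_add_mult)
  hence three: "coprime (6 * t + 2) 3"
    by (simp only: coprime_commute)
  show ?thesis
  proof
    show "coprime (6 * t + 1) (6 * t + 2)" by (rule shift [of _ 1]) simp_all
    show "coprime (6 * t + 1) (6 * t + 3)" using two(1) by (rule shift) simp
    show "coprime (6 * t + 1) (6 * t + 5)" using four by (rule shift) simp
    show "coprime (6 * t + 2) (6 * t + 3)" by (rule shift [of _ 1]) simp_all
    show "coprime (6 * t + 2) (6 * t + 5)" using three by (rule shift) simp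
    show "coprime (6 * t + 3) (6 * t + 5)" using two(2) by (rule shift) simp
  qed (use assms in simp_all)
qed

text \<open>The ratio is 1 + 4 / (6t + 1), at most 1 + 1 / t, so for fixed \<beta> its power tends
  to 1.\<close>

lemma ex_close_base:
  fixes \<beta> :: real
  assumes "\<beta> \<ge> 0"
  shows "\<exists>t\<ge>1. (real (6 * t + 5) / real (6 * t + 1)) powr \<beta> \<le> 3 / 2"
proof -
  have "(\<lambda>t. (1 + 1 / real t) powr \<beta>) \<longlonglongrightarrow> (1 + 0) powr \<beta>"
    by (intro tendsto_intros lim_1_over_n) simp
  hence "eventually (\<lambda>t. (1 + 1 / real t) powr \<beta> < 3 / 2) sequentially"
    by (rule order_tendstoD) simp
  from eventually_conj [OF this eventually_ge_at_top [of 1]]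
  obtain t where t: "(1 + 1 / real t) powr \<beta> < 3 / 2" "t \<ge> 1"
    using eventually_happens trivial_limit_sequentially by blast
  have "real (6 * t + 5) / real (6 * t + 1) \<le> 1 + 1 / real t"
    using t(2) by (simp add: field_simps)
  hence "(real (6 * t + 5) / real (6 * t + 1)) powr \<beta> \<le> (1 + 1 / real t) powr \<beta>"
    using assms by (intro powr_mono2) auto
  thus ?thesis using t by (intro exI [of _ t]) auto
qed

theorem theorem6p1:
  fixes M :: real
  assumes "M \<ge> 1"
  shows "\<exists>(S :: nat set) (n :: nat) (x :: nat \<Rightarrow> nat) (\<alpha>\<^sub>0 :: real).
           gcd_closed S \<and> bij_betw x {..<n} S \<and> \<alpha>\<^sub>0 > M \<and>
           det (power_lcm_matrix n x \<alpha>\<^sub>0) = 0"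
proof -
  \<comment> \<open>The exponent M + 1 makes the root, known only to be at least the prescribed
    exponent, strictly larger than M.\<close>
  obtain t where t: "t \<ge> 1" "(real (6 * t + 5) / real (6 * t + 1)) powr (M + 1) \<le> 3 / 2"
    using ex_close_base [of "M + 1"] assms by auto
  interpret coprime_quadruple "6 * t + 1" "6 * t + 2" "6 * t + 3" "6 * t + 5"
    using t(1) by (rule coprime_quadruple_6)
  have "3 \<le> real (6 * t + 1) powr 1" using t(1) by simp
  also have "\<dots> \<le> real (6 * t + 1) powr (M + 1)"
    using assms by (intro powr_mono) auto
  finally obtain \<alpha> where "\<alpha> \<ge> M + 1" "\<Psi> \<alpha> = 0"
    using root_exists [of "M + 1"] t(2) assms by auto
  moreover obtain x where "bij_betw x {..<card S} S"
    using ex_bij_betw_nat_finite [of S] gcd_closed_S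
    by (auto simp: gcd_closed_def atLeast0LessThan)
  ultimately show ?thesis
    using gcd_closed_S det_eq_0 by (intro exI [of _ S] exI [of _ "card S"] exI [of _ x] exI [of _ \<alpha>]) auto
qed

end
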